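(* For every integer $n\ge1$, the third moment about the mean, $E[(X_n-E[X_n])^3]$, of the number $X_n$ of swaps of Quicksort for a list of length $n$ under Variant I is $$-\frac94 n(n+3)^2+(4n+4)H_1(n)+3(n+1)^2H_2(n)+2(n+1)^3H_3(n).$$
   Context: $H_k(n)=\sum_{i=1}^n \frac1{i^k}$. Variant I of Quicksort, applied to a uniformly random ordering of $n$ distinct elements: the first element of the list is the pivot; every other element is compared with the pivot and, if smaller than the pivot, it is removed and inserted before the pivot (this counts as one swap); then the procedure is applied recursively to the sublists of elements before and after the pivot. Thus partitioning costs $k-1$ swaps when the pivot is the $k$-th smallest element. $X_n$ is the total number of swaps. Formally, the probability generating function $P_n(t)=\sum_{m\ge0}P(X_n=m)t^m$ is determined by $P_0(t)=P_1(t)=1$ and $P_n(t)=\frac1n\sum_{k=1}^n P_{k-1}(t)P_{n-k}(t)\,t^{k-1}$ for $n\ge2$. *)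

theory Defs
  imports "HOL-Probability.Probability"
begin

definition H :: "nat \<Rightarrow> nat \<Rightarrow> real" where
  "H k n = (\<Sum>i=1..n. 1 / real i ^ k)"

(* Returns the sorted list together with the number of swaps made. The elements of xs are scanned
   from left to right; each y < x is removed and inserted immediately before the pivot x, which is
   one swap. After the scan the list reads ls @ x # rs, and length ls swaps have been made. *)
fun quicksort_I :: "'a::linorder list \<Rightarrow> 'a list \<times> nat" where
  "quicksort_I [] = ([], 0)"
| "quicksort_I (x # xs) =
    (let ls = filter (\<lambda>y. y < x) xs;
         rs = filter (\<lambda>y. \<not> y < x) xs;
         (ls', a) = quicksort_I ls;
         (rs', b) = quicksort_I rs
     in (ls' @ x # rs', length ls + a + b))"

definition swaps :: "'a::linorder list \<Rightarrow> nat" where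
  "swaps xs = snd (quicksort_I xs)"

definition random_ordering :: "'a set \<Rightarrow> 'a list pmf" where
  "random_ordering A = pmf_of_set (permutations_of_set A)"

definition mean_swaps :: "'a::linorder set \<Rightarrow> real" where
  "mean_swaps A = measure_pmf.expectation (random_ordering A) (\<lambda>xs. real (swaps xs))"

definition third_central_moment_swaps :: "'a::linorder set \<Rightarrow> real" where
  "third_central_moment_swaps A =
     measure_pmf.expectation (random_ordering A) (\<lambda>xs. (real (swaps xs) - mean_swaps A) ^ 3)"

end

theory Submission
  imports Defs
begin

text \<open>
  The pivots chosen by Quicksort form the binary search tree that arises by inserting the elements
  of the list from left to right, and the number of swaps is the number of pairs (pivot, descendant
  in its left subtree). A search tree with \<open>n\<close> keys has \<open>n + 1\<close> gaps (external nodes). Let the depth of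
  a gap be the number of left turns on the path from the root to it. A key that is appended to the
  list falls into one of the gaps, is swapped once per left turn on the way, and replaces
  that gap, of depth \<open>l\<close>, by two gaps of depths \<open>l + 1\<close> and \<open>l\<close>. Hence the sum of all gap depths is
  the number of swaps plus \<open>n\<close>, and only the list of gap depths matters.

  In a random ordering the last element falls into each of the gaps with the same probability,
  independently of the ordering of the elements before it. So the list of gap depths is a Markov
  chain (\<open>gap_depths_random_ordering\<close>). This replaces the convolution recurrence over the rank of
  the first pivot by recurrences of first order.

  Put \<open>N = n + 1\<close>. The mean gap depth is \<open>a = H\<^sub>1(N) - 1\<close>. With \<open>M\<close>, \<open>Q\<close> and \<open>C\<close> for the sums of
  the first, second and third powers of the \<open>l - a\<close>, the number of swaps minus its mean is \<open>M\<close>, so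
  the third central moment is \<open>E[M\<^sup>3]\<close>. If the next key falls into a gap of depth \<open>a + e\<close>, then \<open>M\<close>
  becomes \<open>M + e\<close>; and the average of \<open>e\<close>, \<open>e\<^sup>2\<close>, \<open>e\<^sup>3\<close> over the gaps is \<open>M/N\<close>, \<open>Q/N\<close>, \<open>C/N\<close>.
  Therefore the recurrence for \<open>E[M\<^sup>3]\<close> involves \<open>E[M Q]\<close> and \<open>E[C]\<close>, and altogether the six
  quantities \<open>E[M]\<close>, \<open>E[Q]\<close>, \<open>E[C]\<close>, \<open>E[M\<^sup>2]\<close>, \<open>E[M Q]\<close>, \<open>E[M\<^sup>3]\<close> satisfy a closed triangular
  system of linear recurrences. Each of them is a linear combination of 1 and the harmonic numbers
  \<open>H\<^sub>k(N)\<close> with coefficients polynomial in \<open>N\<close>, which is verified by induction.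
\<close>

section \<open>Gap depths of a list\<close>

text \<open>
  The depths of the gaps of the search tree of a list, in the order of the gaps from left to right,
  so that an element of rank \<open>r\<close> falls into the gap at position \<open>r\<close>.
\<close>
fun gap_depths :: "'a::linorder list \<Rightarrow> nat list" where
  "gap_depths [] = [0]"
| "gap_depths (x # xs) =
    map Suc (gap_depths (filter (\<lambda>y. y < x) xs)) @ gap_depths (filter (\<lambda>y. \<not> y < x) xs)"

definition split_gap :: "nat \<Rightarrow> nat list \<Rightarrow> nat list" where
  "split_gap r G = take r G @ [Suc (G ! r), G ! r] @ drop (Suc r) G"

lemma length_gap_depths: "length (gap_depths xs) = Suc (length xs)"
proof (induction xs rule: gap_depths.induct)
  case (2 x xs)
  then show ?case
    using sum_length_filter_compl[of "\<lambda>y. y < x" xs] by simp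
qed simp

text \<open>
  Partitioning with pivot \<open>x\<close> takes one swap per smaller element, while the left sublist has one
  gap more than it has elements. These excess gaps, one per pivot, make up the summand \<open>length xs\<close>.
\<close>
lemma sum_list_gap_depths: "sum_list (gap_depths xs) = swaps xs + length xs"
proof (induction xs rule: gap_depths.induct)
  case 1
  then show ?case by (simp add: swaps_def)
next
  case (2 x xs)
  have "sum_list (map Suc G) = sum_list G + length G" for G :: "nat list"
    by (induction G) auto
  then show ?case
    using 2 sum_length_filter_compl[of "\<lambda>y. y < x" xs]
    by (simp add: swaps_def length_gap_depths Let_def case_prod_beta)
qed

lemma split_gap_append_left:
  "r < length G \<Longrightarrow> split_gap r (G @ G') = split_gap r G @ G'"
  by (simp add: split_gap_def nth_append)

lemma split_gap_append_right:
  "split_gap (length G + r) (G @ G') = G @ split_gap r G'"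
  by (simp add: split_gap_def nth_append)

lemma split_gap_map_Suc:
  "r < length G \<Longrightarrow> split_gap r (map Suc G) = map Suc (split_gap r G)"
  by (simp add: split_gap_def take_map drop_map)

text \<open>
  The appended element is compared last in every partitioning step, so the earlier pivots and
  sublists are unaffected: it follows the branches of the existing tree down to the gap given by its
  rank and becomes a pivot without descendants there.
\<close>
lemma gap_depths_snoc:
  assumes "y \<notin> set xs"
  shows "gap_depths (xs @ [y]) =
           split_gap (length (filter (\<lambda>x. x < y) xs)) (gap_depths xs)"
  using assms
proof (induction xs rule: gap_depths.induct)
  case 1
  then show ?case by (simp add: split_gap_def)
next
  case (2 x xs)
  let ?ls = "filter (\<lambda>z. z < x) xs" and ?rs = "filter (\<lambda>z. \<not> z < x) xs"
  show ?case
  proof (cases "y < x")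
    case True
    \<comment> \<open>All elements below \<open>y\<close> are in the left sublist, so the rank of \<open>y\<close> is the same there.\<close>
    have rank: "filter (\<lambda>z. z < y) (x # xs) = filter (\<lambda>z. z < y) ?ls"
      using True by (auto intro!: filter_cong)
    have "length (filter (\<lambda>z. z < y) ?ls) < length (gap_depths ?ls)"
      by (simp add: length_gap_depths less_Suc_eq_le del: filter_filter)
    then show ?thesis
      using 2 True
      unfolding rank by (simp add: split_gap_append_left split_gap_map_Suc del: filter_filter)
  next
    case False
    then have "x < y"
      using 2(3) by auto
    have "length (filter (\<lambda>z. z < y) xs) =
            length ?ls + length (filter (\<lambda>z. z < y) ?rs)"
      using \<open>x < y\<close> by (induction xs) auto
    \<comment> \<open>The pivot and the left sublist lie below \<open>y\<close>; together they are as many as the gaps on the left.\<close>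
    then have rank: "length (filter (\<lambda>z. z < y) (x # xs)) =
            length (map Suc (gap_depths ?ls)) + length (filter (\<lambda>z. z < y) ?rs)"
      using \<open>x < y\<close> by (simp add: length_gap_depths del: filter_filter)
    show ?thesis
      using 2 False
      unfolding rank split_gap_append_right gap_depths.simps
      by (simp del: filter_filter)
  qed
qed

section \<open>The Markov chain of gap depths\<close>

fun random_gaps :: "nat \<Rightarrow> nat list pmf" where
  "random_gaps 0 = return_pmf [0]"
| "random_gaps (Suc n) =
    bind_pmf (random_gaps n) (\<lambda>G. map_pmf (\<lambda>r. split_gap r G) (pmf_of_set {..n}))"

lemma finite_random_gaps [simp]: "finite (set_pmf (random_gaps n))"
  by (induction n) auto

lemma length_random_gaps: "G \<in> set_pmf (random_gaps n) \<Longrightarrow> length G = Suc n"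
  by (induction n arbitrary: G) (auto simp: split_gap_def)

lemma bij_betw_rank:
  fixes A :: "'a::linorder set"
  assumes "finite A"
  shows "bij_betw (\<lambda>y. card {x \<in> A. x < y}) A {..<card A}"
proof -
  let ?rank = "\<lambda>y. card {x \<in> A. x < y}"
  have mono: "?rank x < ?rank y" if "x \<in> A" "x < y" for x y
    using assms that by (intro psubset_card_mono) auto
  have inj: "inj_on ?rank A"
  proof (rule inj_onI)
    fix x y assume "x \<in> A" "y \<in> A" "?rank x = ?rank y"
    then show "x = y"
      using mono[of x y] mono[of y x] by (cases x y rule: linorder_cases) auto
  qed
  have "?rank ` A \<subseteq> {..<card A}"
    using assms by (auto intro!: psubset_card_mono)
  then have "?rank ` A = {..<card A}"
    using inj by (intro card_subset_eq) (auto simp: card_image)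
  with inj show ?thesis by (simp add: bij_betw_def)
qed

text \<open>
  Reversal preserves the uniform distribution on permutations, so choosing the first element
  uniformly, as in \<open>random_permutation_of_set\<close>, can be turned into choosing the last one.
\<close>
lemma random_ordering_snoc:
  assumes "finite A" "A \<noteq> {}"
  shows "random_ordering A =
    bind_pmf (pmf_of_set A) (\<lambda>y. map_pmf (\<lambda>xs. xs @ [y]) (random_ordering (A - {y})))"
proof -
  have rev: "map_pmf rev (random_ordering B) = random_ordering B" if "finite B" for B :: "'a set"
    using that unfolding random_ordering_def
    by (subst map_pmf_of_set_inj) (auto simp: inj_on_def)
  have "random_ordering A = map_pmf rev (random_ordering A)"
    using assms by (simp add: rev)
  also have "\<dots> = bind_pmf (pmf_of_set A)
      (\<lambda>y. map_pmf (\<lambda>xs. xs @ [y]) (map_pmf rev (random_ordering (A - {y}))))"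
    unfolding random_ordering_def
    by (subst random_permutation_of_set[OF assms])
       (simp add: map_bind_pmf map_pmf_def[symmetric] pmf.map_comp o_def)
  finally show ?thesis
    using assms by (simp add: rev)
qed

text \<open>
  Conditioned on the last element \<open>y\<close>, the rank of \<open>y\<close> is a constant and the preceding elements are
  a random ordering of \<open>A - {y}\<close>, whose gap depths have, by induction, a distribution that depends
  on the cardinality alone. So the rank, which is uniform, is independent of these gap depths.
\<close>
lemma gap_depths_random_ordering:
  assumes "finite A" "card A = n"
  shows "map_pmf gap_depths (random_ordering A) = random_gaps n"
  using assms
proof (induction n arbitrary: A)
  case 0
  then show ?case by (simp add: random_ordering_def pmf_of_set_singleton)
next
  case (Suc n)
  let ?rank = "\<lambda>y. card {x \<in> A. x < y}"
  have ne: "A \<noteq> {}" using Suc.prems by auto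
  have last: "map_pmf (\<lambda>xs. gap_depths (xs @ [y])) (random_ordering (A - {y})) =
      map_pmf (split_gap (?rank y)) (random_gaps n)" if "y \<in> A" for y
  proof -
    have "map_pmf (\<lambda>xs. gap_depths (xs @ [y])) (random_ordering (A - {y})) =
      map_pmf (\<lambda>xs. split_gap (?rank y) (gap_depths xs)) (random_ordering (A - {y}))"
    proof (intro map_pmf_cong refl)
      fix xs assume "xs \<in> set_pmf (random_ordering (A - {y}))"
      then have xs: "set xs = A - {y}" "distinct xs"
        using Suc.prems by (auto simp: random_ordering_def dest: permutations_of_setD)
      have "length (filter (\<lambda>x. x < y) xs) = ?rank y"
        using xs distinct_length_filter[of xs "\<lambda>x. x < y"]
        by (auto intro!: arg_cong[where f = card])
      then show "gap_depths (xs @ [y]) = split_gap (?rank y) (gap_depths xs)"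
        using xs by (subst gap_depths_snoc) auto
    qed
    also have "\<dots> = map_pmf (split_gap (?rank y)) (map_pmf gap_depths (random_ordering (A - {y})))"
      by (simp add: pmf.map_comp o_def)
    also have "map_pmf gap_depths (random_ordering (A - {y})) = random_gaps n"
      using Suc that by simp
    finally show ?thesis .
  qed
  have "map_pmf gap_depths (random_ordering A) =
      bind_pmf (pmf_of_set A) (\<lambda>y. map_pmf (split_gap (?rank y)) (random_gaps n))"
    unfolding random_ordering_snoc[OF Suc.prems(1) ne] map_bind_pmf
    using Suc.prems(1) ne by (intro bind_pmf_cong refl) (simp add: pmf.map_comp o_def last)
  also have "\<dots> = bind_pmf (map_pmf ?rank (pmf_of_set A))
      (\<lambda>r. map_pmf (split_gap r) (random_gaps n))"
    by (simp add: bind_map_pmf)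
  also have "map_pmf ?rank (pmf_of_set A) = pmf_of_set {..n}"
    using bij_betw_rank[of A] Suc.prems ne
    by (intro map_pmf_of_set_bij_betw) (auto simp: lessThan_Suc_atMost)
  also have "bind_pmf (pmf_of_set {..n}) (\<lambda>r. map_pmf (split_gap r) (random_gaps n)) =
      random_gaps (Suc n)"
    unfolding map_pmf_def random_gaps.simps by (rule bind_commute_pmf)
  finally show ?case .
qed

section \<open>Averaging over the gaps\<close>

definition gap_mean :: "nat \<Rightarrow> (nat list \<Rightarrow> real) \<Rightarrow> real" where
  "gap_mean n F = measure_pmf.expectation (random_gaps n) F"

lemma integrable_random_gaps [simp]:
  "integrable (measure_pmf (random_gaps n)) (F :: nat list \<Rightarrow> real)"
  by (rule integrable_measure_pmf_finite) simp

lemma gap_mean_linear: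
  "gap_mean n (\<lambda>G. F G + F' G) = gap_mean n F + gap_mean n F'"
  "gap_mean n (\<lambda>G. c * F G) = c * gap_mean n F"
  "gap_mean n (\<lambda>G. c) = c"
  by (simp_all add: gap_mean_def)

text \<open>
  A list of gap depths of length \<open>N\<close> comes from \<open>N - 1\<close> keys, and the expected depth of
  a uniformly chosen gap is then \<open>H\<^sub>1(N) - 1\<close>. Taking \<open>N\<close> from the list lets the centre move along
  with the chain.
\<close>
definition centred :: "nat \<Rightarrow> nat list \<Rightarrow> real" where
  "centred k G = (\<Sum>l\<leftarrow>G. (real l - (H 1 (length G) - 1)) ^ k)"

lemma gap_mean_Suc:
  assumes "\<And>G. length G = Suc n \<Longrightarrow> (\<Sum>r\<le>n. F (split_gap r G)) / (real n + 1) = F' G"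
  shows "gap_mean (Suc n) F = gap_mean n F'"
proof -
  have "gap_mean (Suc n) F =
      (\<Sum>G\<in>set_pmf (random_gaps n). pmf (random_gaps n) G *
         measure_pmf.expectation (map_pmf (\<lambda>r. split_gap r G) (pmf_of_set {..n})) F)"
    unfolding gap_mean_def random_gaps.simps
    by (subst pmf_expectation_bind[where A = "set_pmf (random_gaps n)"]) auto
  also have "\<dots> = (\<Sum>G\<in>set_pmf (random_gaps n). pmf (random_gaps n) G * F' G)"
    using assms by (intro sum.cong) (auto simp: integral_pmf_of_set length_random_gaps add.commute)
  also have "\<dots> = gap_mean n F'"
    unfolding gap_mean_def by (subst integral_measure_pmf[of "set_pmf (random_gaps n)"]) auto
  finally show ?thesis .
qed

lemma sum_list_split_gap:
  fixes f :: "nat \<Rightarrow> real"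
  assumes "r < length G"
  shows "(\<Sum>l\<leftarrow>split_gap r G. f l) = (\<Sum>l\<leftarrow>G. f l) + f (Suc (G ! r))"
proof -
  have "G = take r G @ G ! r # drop (Suc r) G"
    using assms by (rule id_take_nth_drop)
  then have "(\<Sum>l\<leftarrow>G. f l) = (\<Sum>l\<leftarrow>take r G. f l) + f (G ! r) + (\<Sum>l\<leftarrow>drop (Suc r) G. f l)"
    by (metis (no_types, lifting) add.assoc list.simps(9) map_append sum_list.Cons sum_list_append)
  then show ?thesis
    by (simp add: split_gap_def)
qed

lemma H_Suc: "H k (Suc n) = H k n + 1 / (real n + 1) ^ k"
  by (simp add: H_def add.commute)

text \<open>
  Splitting a gap of depth \<open>l\<close> adds an entry \<open>l + 1\<close> and moves the centre up by \<open>\<delta>\<close>. For the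
  first powers the shifts \<open>- (n + 1) \<delta>\<close> of the old entries and the \<open>1 - \<delta>\<close> of the new one cancel.
\<close>
lemma centred_split_gap:
  fixes n :: nat
  defines "\<delta> \<equiv> 1 / (real n + 2)"
  assumes len: "length G = Suc n" and r: "r \<le> n"
  defines "e \<equiv> real (G ! r) - (H 1 (Suc n) - 1)"
  shows "centred 1 (split_gap r G) = centred 1 G + e"
    and "centred 2 (split_gap r G) =
           centred 2 G - 2 * \<delta> * centred 1 G + (real n + 1) * \<delta>\<^sup>2 + (e + 1 - \<delta>)\<^sup>2"
    and "centred 3 (split_gap r G) =
           centred 3 G - 3 * \<delta> * centred 2 G + 3 * \<delta>\<^sup>2 * centred 1 G
             - (real n + 1) * \<delta> ^ 3 + (e + 1 - \<delta>) ^ 3"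
proof -
  define a where "a = H 1 (Suc n) - 1"
  have len': "length (split_gap r G) = Suc (Suc n)"
    using len r by (simp add: split_gap_def)
  have shift: "centred k (split_gap r G) =
      (\<Sum>l\<leftarrow>G. ((real l - a) - \<delta>) ^ k) + (e + 1 - \<delta>) ^ k" for k
    using len r
    by (simp add: centred_def len' sum_list_split_gap H_Suc[of _ "Suc n"] \<delta>_def e_def a_def
        algebra_simps)
  have cent: "centred k G = (\<Sum>l\<leftarrow>G. (real l - a) ^ k)" for k
    by (simp add: centred_def len a_def)
  have pow1: "(\<Sum>l\<leftarrow>L. ((real l - a) - \<delta>)) = (\<Sum>l\<leftarrow>L. (real l - a)) - length L * \<delta>"
    for L :: "nat list" by (induction L) (auto simp: algebra_simps)
  have pow2: "(\<Sum>l\<leftarrow>L. ((real l - a) - \<delta>)\<^sup>2) =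
      (\<Sum>l\<leftarrow>L. (real l - a)\<^sup>2) - 2 * \<delta> * (\<Sum>l\<leftarrow>L. (real l - a)) + length L * \<delta>\<^sup>2"
    for L :: "nat list" by (induction L) (auto simp: algebra_simps power2_eq_square)
  have pow3: "(\<Sum>l\<leftarrow>L. ((real l - a) - \<delta>) ^ 3) =
      (\<Sum>l\<leftarrow>L. (real l - a) ^ 3) - 3 * \<delta> * (\<Sum>l\<leftarrow>L. (real l - a)\<^sup>2)
        + 3 * \<delta>\<^sup>2 * (\<Sum>l\<leftarrow>L. (real l - a)) - length L * \<delta> ^ 3"
    for L :: "nat list"
    by (induction L) (auto simp: algebra_simps power2_eq_square power3_eq_cube)
  have "real (Suc n) * \<delta> = 1 - \<delta>"
    by (simp add: \<delta>_def field_simps)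
  then show "centred 1 (split_gap r G) = centred 1 G + e"
    using shift[of 1] cent[of 1] pow1[of G] len by simp
  show "centred 2 (split_gap r G) =
      centred 2 G - 2 * \<delta> * centred 1 G + (real n + 1) * \<delta>\<^sup>2 + (e + 1 - \<delta>)\<^sup>2"
    using shift[of 2] cent[of 1] cent[of 2] pow2[of G] len by (simp add: add.commute)
  show "centred 3 (split_gap r G) =
      centred 3 G - 3 * \<delta> * centred 2 G + 3 * \<delta>\<^sup>2 * centred 1 G
        - (real n + 1) * \<delta> ^ 3 + (e + 1 - \<delta>) ^ 3"
    using shift[of 3] cent[of 1] cent[of 2] cent[of 3] pow3[of G] len by (simp add: add.commute)
qed

text \<open>
  The centred power sums are the moments of the centred depth \<open>e\<close> of a uniformly chosen gap, up to
  the factor \<open>N\<close>. So averaging a polynomial in \<open>e\<close> amounts to replacing \<open>e ^ k\<close> by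
  \<open>centred k G / N\<close>.
\<close>
lemma gap_mean_step:
  fixes F :: "nat list \<Rightarrow> real" and n :: nat
  defines "N \<equiv> real n + 1"
  assumes F: "\<And>G r e. length G = Suc n \<Longrightarrow> r \<le> n \<Longrightarrow> e = real (G ! r) - (H 1 (Suc n) - 1) \<Longrightarrow>
                F (split_gap r G) = c\<^sub>0 G + c\<^sub>1 G * e + c\<^sub>2 G * e\<^sup>2 + c\<^sub>3 G * e ^ 3"
    and F': "\<And>G. c\<^sub>0 G + (c\<^sub>1 G * centred 1 G + c\<^sub>2 G * centred 2 G + c\<^sub>3 G * centred 3 G) / N = F' G"
  shows "gap_mean (Suc n) F = gap_mean n F'"
proof (rule gap_mean_Suc)
  fix G :: "nat list"
  assume len: "length G = Suc n"
  let ?e = "\<lambda>r. real (G ! r) - (H 1 (Suc n) - 1)"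
  have cent: "centred k G = (\<Sum>r\<le>n. ?e r ^ k)" for k
    by (simp add: centred_def len sum_list_sum_nth atLeast0LessThan lessThan_Suc_atMost)
  have "(\<Sum>r\<le>n. F (split_gap r G)) =
      (\<Sum>r\<le>n. c\<^sub>0 G + c\<^sub>1 G * ?e r ^ 1 + c\<^sub>2 G * ?e r ^ 2 + c\<^sub>3 G * ?e r ^ 3)"
    by (intro sum.cong) (simp_all add: F[OF len])
  also have "\<dots> = N * c\<^sub>0 G + c\<^sub>1 G * centred 1 G + c\<^sub>2 G * centred 2 G + c\<^sub>3 G * centred 3 G"
    unfolding cent sum_distrib_left N_def by (simp add: sum.distrib)
  also have "\<dots> / N = F' G"
    unfolding F'[symmetric] N_def by (simp add: field_simps)
  finally show "(\<Sum>r\<le>n. F (split_gap r G)) / (real n + 1) = F' G"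
    by (simp add: N_def)
qed

section \<open>Recurrences for the moments\<close>

text \<open>
  In each of the following proofs, the \<open>c\<^sub>k\<close> are the coefficients of the powers of \<open>e\<close> when the
  statistic of the split list is expanded with \<open>centred_split_gap\<close>. After averaging, \<open>\<delta> = 1 / (N + 1)\<close>
  gives \<open>N * \<delta> = 1 - \<delta>\<close>, which makes most of the mixed terms cancel.
\<close>

context
  fixes n :: nat and N \<delta> :: real
  defines "N \<equiv> real n + 1" and "\<delta> \<equiv> 1 / (real n + 2)"
begin

private lemma N_pos: "N > 0"
  by (simp add: N_def)

private lemma \<delta>_eq: "\<delta> = 1 / (N + 1)"
  by (simp add: N_def \<delta>_def)

private lemmas split = centred_split_gap[of _ n, folded \<delta>_def N_def]

lemma gap_mean_centred_1_Suc:
  "gap_mean (Suc n) (centred 1) = (1 + 1 / N) * gap_mean n (centred 1)"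
proof -
  have "gap_mean (Suc n) (centred 1) = gap_mean n (\<lambda>G. (1 + 1 / N) * centred 1 G)"
  proof (rule gap_mean_step[where
        c\<^sub>0 = "centred 1" and c\<^sub>1 = "\<lambda>_. 1" and c\<^sub>2 = "\<lambda>_. 0" and c\<^sub>3 = "\<lambda>_. 0"], goal_cases)
    case (1 G r e)
    show ?case
      unfolding split[OF 1(1,2)] 1(3)[symmetric] by algebra
  next
    case (2 G)
    show ?case
      using N_pos unfolding N_def[symmetric] by (simp add: divide_simps) algebra
  qed
  then show ?thesis by (simp only: gap_mean_linear)
qed

lemma gap_mean_centred_2_Suc:
  "gap_mean (Suc n) (centred 2) = (1 + 1 / N) * gap_mean n (centred 2) + N / (N + 1)"
proof -
  have "gap_mean (Suc n) (centred 2) = gap_mean n (\<lambda>G. (1 + 1 / N) * centred 2 G + N / (N + 1))"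
  proof (rule gap_mean_step[where
        c\<^sub>0 = "\<lambda>G. centred 2 G - 2 * \<delta> * centred 1 G + N * \<delta>\<^sup>2 + (1 - \<delta>)\<^sup>2" and
        c\<^sub>1 = "\<lambda>_. 2 * (1 - \<delta>)" and c\<^sub>2 = "\<lambda>_. 1" and c\<^sub>3 = "\<lambda>_. 0"], goal_cases)
    case (1 G r e)
    show ?case
      unfolding split[OF 1(1,2)] 1(3)[symmetric] by algebra
  next
    case (2 G)
    show ?case
      using N_pos unfolding N_def[symmetric] \<delta>_eq by (simp add: divide_simps) algebra
  qed
  then show ?thesis by (simp only: gap_mean_linear)
qed

lemma gap_mean_centred_3_Suc:
  "gap_mean (Suc n) (centred 3) =
     (1 + 1 / N) * gap_mean n (centred 3) + 3 / (N + 1) * gap_mean n (centred 1)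
       + N * (N - 1) / (N + 1)\<^sup>2"
proof -
  have "gap_mean (Suc n) (centred 3) = gap_mean n
      (\<lambda>G. (1 + 1 / N) * centred 3 G + 3 / (N + 1) * centred 1 G + N * (N - 1) / (N + 1)\<^sup>2)"
  proof (rule gap_mean_step[where
        c\<^sub>0 = "\<lambda>G. centred 3 G - 3 * \<delta> * centred 2 G + 3 * \<delta>\<^sup>2 * centred 1 G - N * \<delta> ^ 3 + (1 - \<delta>) ^ 3" and
        c\<^sub>1 = "\<lambda>_. 3 * (1 - \<delta>)\<^sup>2" and c\<^sub>2 = "\<lambda>_. 3 * (1 - \<delta>)" and c\<^sub>3 = "\<lambda>_. 1"], goal_cases)
    case (1 G r e)
    show ?case
      unfolding split[OF 1(1,2)] 1(3)[symmetric] by algebra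
  next
    case (2 G)
    show ?case
      using N_pos unfolding N_def[symmetric] \<delta>_eq by (simp add: divide_simps) algebra
  qed
  then show ?thesis by (simp only: gap_mean_linear)
qed

lemma gap_mean_centred_1_square_Suc:
  "gap_mean (Suc n) (\<lambda>G. (centred 1 G)\<^sup>2) =
     (1 + 2 / N) * gap_mean n (\<lambda>G. (centred 1 G)\<^sup>2) + 1 / N * gap_mean n (centred 2)"
proof -
  have "gap_mean (Suc n) (\<lambda>G. (centred 1 G)\<^sup>2) =
      gap_mean n (\<lambda>G. (1 + 2 / N) * (centred 1 G)\<^sup>2 + 1 / N * centred 2 G)"
  proof (rule gap_mean_step[where
        c\<^sub>0 = "\<lambda>G. (centred 1 G)\<^sup>2" and c\<^sub>1 = "\<lambda>G. 2 * centred 1 G" and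
        c\<^sub>2 = "\<lambda>_. 1" and c\<^sub>3 = "\<lambda>_. 0"], goal_cases)
    case (1 G r e)
    show ?case
      unfolding split[OF 1(1,2)] 1(3)[symmetric] by algebra
  next
    case (2 G)
    show ?case
      using N_pos unfolding N_def[symmetric] by (simp add: divide_simps) algebra
  qed
  then show ?thesis by (simp only: gap_mean_linear)
qed

lemma gap_mean_centred_1_centred_2_Suc:
  "gap_mean (Suc n) (\<lambda>G. centred 1 G * centred 2 G) =
     (1 + 2 / N) * gap_mean n (\<lambda>G. centred 1 G * centred 2 G)
       + (- 2 / (N * (N + 1))) * gap_mean n (\<lambda>G. (centred 1 G)\<^sup>2)
       + 1 / N * gap_mean n (centred 3) + 2 / (N + 1) * gap_mean n (centred 2)
       + gap_mean n (centred 1)"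
proof -
  have "gap_mean (Suc n) (\<lambda>G. centred 1 G * centred 2 G) =
      gap_mean n (\<lambda>G. (1 + 2 / N) * (centred 1 G * centred 2 G)
        + (- 2 / (N * (N + 1))) * (centred 1 G)\<^sup>2
        + 1 / N * centred 3 G + 2 / (N + 1) * centred 2 G + centred 1 G)"
  proof (rule gap_mean_step[where
        c\<^sub>0 = "\<lambda>G. centred 1 G * (centred 2 G - 2 * \<delta> * centred 1 G + N * \<delta>\<^sup>2 + (1 - \<delta>)\<^sup>2)" and
        c\<^sub>1 = "\<lambda>G. 2 * (1 - \<delta>) * centred 1 G
          + (centred 2 G - 2 * \<delta> * centred 1 G + N * \<delta>\<^sup>2 + (1 - \<delta>)\<^sup>2)" and
        c\<^sub>2 = "\<lambda>G. centred 1 G + 2 * (1 - \<delta>)" and c\<^sub>3 = "\<lambda>_. 1"], goal_cases)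
    case (1 G r e)
    show ?case
      unfolding split[OF 1(1,2)] 1(3)[symmetric] by algebra
  next
    case (2 G)
    show ?case
      using N_pos unfolding N_def[symmetric] \<delta>_eq by (simp add: divide_simps) algebra
  qed
  then show ?thesis by (simp only: gap_mean_linear)
qed

lemma gap_mean_centred_1_cube_Suc:
  "gap_mean (Suc n) (\<lambda>G. centred 1 G ^ 3) =
     (1 + 3 / N) * gap_mean n (\<lambda>G. centred 1 G ^ 3)
       + 3 / N * gap_mean n (\<lambda>G. centred 1 G * centred 2 G) + 1 / N * gap_mean n (centred 3)"
proof -
  have "gap_mean (Suc n) (\<lambda>G. centred 1 G ^ 3) =
      gap_mean n (\<lambda>G. (1 + 3 / N) * centred 1 G ^ 3
        + 3 / N * (centred 1 G * centred 2 G) + 1 / N * centred 3 G)"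
  proof (rule gap_mean_step[where
        c\<^sub>0 = "\<lambda>G. centred 1 G ^ 3" and c\<^sub>1 = "\<lambda>G. 3 * (centred 1 G)\<^sup>2" and
        c\<^sub>2 = "\<lambda>G. 3 * centred 1 G" and c\<^sub>3 = "\<lambda>_. 1"], goal_cases)
    case (1 G r e)
    show ?case
      unfolding split[OF 1(1,2)] 1(3)[symmetric] by algebra
  next
    case (2 G)
    show ?case
      using N_pos unfolding N_def[symmetric] by (simp add: divide_simps) algebra
  qed
  then show ?thesis by (simp only: gap_mean_linear)
qed

end

section \<open>Closed forms of the moments\<close>

lemma centred_singleton_0: "centred k [0] = 0 ^ k"
  by (simp add: centred_def H_def)

lemma gap_mean_0: "gap_mean 0 F = F [0]"
  by (simp add: gap_mean_def)

lemma H_1: "H k (Suc 0) = 1"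
  by (simp add: H_def)

lemma gap_mean_centred_1: "gap_mean n (centred 1) = 0"
proof (induction n)
  case 0
  show ?case by (simp add: gap_mean_0 centred_singleton_0)
next
  case (Suc n)
  then show ?case by (simp only: gap_mean_centred_1_Suc)
qed

text \<open>
  The expected generating function of the gap depths, \<open>E[\<Sum>z ^ l]\<close>, is multiplied by \<open>1 + z / N\<close> in
  each step. So the depth of a random gap is distributed like a sum of independent Bernoulli
  variables with parameters \<open>p = 1/2, \<dots>, 1/(n + 1)\<close>. This explains the next two formulas: their
  right-hand sides are \<open>N\<close> times the sums of \<open>p - p\<^sup>2\<close> and of \<open>p - 3 p\<^sup>2 + 2 p\<^sup>3\<close>, the second and
  third central moments of a Bernoulli variable. The first summands of the \<open>H k\<close> would
  belong to \<open>p = 1\<close> and cancel.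
\<close>
lemma gap_mean_centred_2:
  "gap_mean n (centred 2) = (real n + 1) * (H 1 (Suc n) - H 2 (Suc n))"
proof (induction n)
  case 0
  show ?case by (simp add: gap_mean_0 centred_singleton_0 H_1)
next
  case (Suc n)
  define N where "N = real n + 1"
  have N: "N > 0" "real (Suc n) = N" by (simp_all add: N_def)
  show ?case
    unfolding gap_mean_centred_2_Suc Suc H_Suc[of _ "Suc n"] N(2) N_def[symmetric]
    using N(1) by (simp add: divide_simps) algebra
qed

lemma gap_mean_centred_3:
  "gap_mean n (centred 3) =
     (real n + 1) * (H 1 (Suc n) - 3 * H 2 (Suc n) + 2 * H 3 (Suc n))"
proof (induction n)
  case 0
  show ?case by (simp add: gap_mean_0 centred_singleton_0 H_1)
next
  case (Suc n)
  define N where "N = real n + 1"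
  have N: "N > 0" "real (Suc n) = N" by (simp_all add: N_def)
  show ?case
    unfolding gap_mean_centred_3_Suc gap_mean_centred_1 Suc H_Suc[of _ "Suc n"] N(2) N_def[symmetric]
    using N(1) by (simp add: divide_simps) algebra
qed

text \<open>This is the variance of the number of swaps.\<close>
lemma gap_mean_centred_1_square:
  "gap_mean n (\<lambda>G. (centred 1 G)\<^sup>2) =
     (real n + 1) * (2 * (real n + 1) - H 1 (Suc n) - (real n + 1) * H 2 (Suc n))"
proof (induction n)
  case 0
  show ?case by (simp add: gap_mean_0 centred_singleton_0 H_1)
next
  case (Suc n)
  define N where "N = real n + 1"
  have N: "N > 0" "real (Suc n) = N" by (simp_all add: N_def)
  show ?case
    unfolding gap_mean_centred_1_square_Suc gap_mean_centred_2 Suc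
      H_Suc[of _ "Suc n"] N(2) N_def[symmetric]
    using N(1) by (simp add: divide_simps) algebra
qed

text \<open>
  The closed form is forced by that of \<open>E[M\<^sup>3]\<close> below: solve the recurrence
  \<open>gap_mean_centred_1_cube_Suc\<close> for the mixed moment.
\<close>
lemma gap_mean_centred_1_centred_2:
  "gap_mean n (\<lambda>G. centred 1 G * centred 2 G) =
     (real n + 1) * (2 * (real n + 1) * H 3 (Suc n) + (1 - real n) * H 2 (Suc n) - 3 * H 1 (Suc n))"
proof (induction n)
  case 0
  show ?case by (simp add: gap_mean_0 centred_singleton_0 H_1)
next
  case (Suc n)
  define N where "N = real n + 1"
  have N: "N > 0" "real (Suc n) = N" "real n = N - 1" by (simp_all add: N_def)
  show ?case
    unfolding gap_mean_centred_1_centred_2_Suc gap_mean_centred_1 gap_mean_centred_2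
      gap_mean_centred_3 gap_mean_centred_1_square Suc H_Suc[of _ "Suc n"] N(2) N_def[symmetric]
    using N(1) unfolding N(3) by (simp add: divide_simps) algebra
qed

lemma gap_mean_centred_1_cube:
  "gap_mean n (\<lambda>G. centred 1 G ^ 3) =
     2 * (real n + 1) ^ 3 * H 3 (Suc n) + 3 * (real n + 1)\<^sup>2 * H 2 (Suc n)
       + 4 * (real n + 1) * H 1 (Suc n) - 9 / 4 * (real n + 1)\<^sup>2 * (real n + 4)"
proof (induction n)
  case 0
  show ?case by (simp add: gap_mean_0 centred_singleton_0 H_1)
next
  case (Suc n)
  define N where "N = real n + 1"
  have N: "N > 0" "real (Suc n) = N" "real n = N - 1" by (simp_all add: N_def)
  show ?case
    unfolding gap_mean_centred_1_cube_Suc gap_mean_centred_1_centred_2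
      gap_mean_centred_3 Suc H_Suc[of _ "Suc n"] N(2) N_def[symmetric]
    using N(1) unfolding N(3) by (simp add: divide_simps) algebra
qed

section \<open>Third central moment\<close>

lemma expectation_random_ordering:
  fixes f :: "nat list \<Rightarrow> real"
  assumes "finite A"
  shows "measure_pmf.expectation (random_ordering A) (\<lambda>xs. f (gap_depths xs)) = gap_mean (card A) f"
  unfolding gap_mean_def gap_depths_random_ordering[OF assms refl, symmetric] by simp

lemma swaps_random_ordering:
  assumes "finite A" "xs \<in> set_pmf (random_ordering A)"
  shows "real (swaps xs) = centred 1 (gap_depths xs)
           + ((real (card A) + 1) * (H 1 (Suc (card A)) - 1) - real (card A))"
proof -
  have len: "length xs = card A"
    using assms by (auto simp: random_ordering_def length_finite_permutations_of_set)
  have "(\<Sum>l\<leftarrow>G. real l - a) = real (sum_list G) - real (length G) * a" for G :: "nat list" and a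
    by (induction G) (auto simp: algebra_simps)
  then have "centred 1 (gap_depths xs) = real (sum_list (gap_depths xs))
      - real (length (gap_depths xs)) * (H 1 (length (gap_depths xs)) - 1)"
    unfolding centred_def power_one_right .
  then show ?thesis
    unfolding sum_list_gap_depths length_gap_depths len by simp
qed

lemma mean_swaps_eq:
  assumes "finite A"
  shows "mean_swaps A = (real (card A) + 1) * (H 1 (Suc (card A)) - 1) - real (card A)"
proof -
  let ?\<mu> = "(real (card A) + 1) * (H 1 (Suc (card A)) - 1) - real (card A)"
  have "mean_swaps A =
      measure_pmf.expectation (random_ordering A) (\<lambda>xs. centred 1 (gap_depths xs) + ?\<mu>)"
    unfolding mean_swaps_def
    by (intro integral_cong_AE) (auto simp: AE_measure_pmf_iff swaps_random_ordering[OF assms])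
  also have "\<dots> = gap_mean (card A) (\<lambda>G. centred 1 G + ?\<mu>)"
    using assms by (rule expectation_random_ordering)
  also have "\<dots> = ?\<mu>"
    by (simp only: gap_mean_linear gap_mean_centred_1)
  finally show ?thesis .
qed

theorem theorem4p7:
  fixes A :: "'a::linorder set" and n :: nat
  assumes "finite A" and "card A = n" and "n \<ge> 1"
  shows "third_central_moment_swaps A =
    - (9 / 4) * real n * (real n + 3) ^ 2 + (4 * real n + 4) * H 1 n
    + 3 * (real n + 1) ^ 2 * H 2 n + 2 * (real n + 1) ^ 3 * H 3 n"
proof -
  have "third_central_moment_swaps A =
      measure_pmf.expectation (random_ordering A) (\<lambda>xs. centred 1 (gap_depths xs) ^ 3)"
    unfolding third_central_moment_swaps_def
    using assms(1)
    by (intro integral_cong_AE)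
       (auto simp: AE_measure_pmf_iff swaps_random_ordering mean_swaps_eq)
  also have "\<dots> = gap_mean n (\<lambda>G. centred 1 G ^ 3)"
    using expectation_random_ordering[OF assms(1)] assms(2) by simp
  \<comment> \<open>Passing from \<open>H k (Suc n)\<close> to \<open>H k n\<close> contributes 2 + 3 + 4 = 9, which turns
      \<open>N\<^sup>2 (N + 3)\<close> into \<open>N\<^sup>3 + 3 N\<^sup>2 - 4 = n (n + 3)\<^sup>2\<close>.\<close>
  also have "\<dots> = - (9 / 4) * real n * (real n + 3) ^ 2 + (4 * real n + 4) * H 1 n
    + 3 * (real n + 1) ^ 2 * H 2 n + 2 * (real n + 1) ^ 3 * H 3 n"
    unfolding gap_mean_centred_1_cube H_Suc
    by (simp add: divide_simps) algebra
  finally show ?thesis .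
qed

end
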